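(* Let $W\subseteq\mathbb{R}^n$ be closed and convex, let $f(w,z)$ be an $L$-smooth convex loss function in $w\in W$ for each $z\in\mathcal{Z}$, and assume that the stochastic gradient $\nabla_w f(w,z)$ has $\sigma^2$-bounded variance for all $w\in W$. If the update rule $\phi$ used in a serial setting has an expected optimality gap bounded by $\bar\psi(\sigma^2,m)$ (in the sense of the context), then the expected optimality gap of the DMB algorithm for stochastic optimization with batch size $b$, after processing $m$ samples, is at most $$\bar\psi\!\left(\frac{\sigma^2}{b},\frac mb\right).$$ If $\bar\psi(\sigma^2,m)=\frac{2D^2L}{m}+\frac{2D\sigma}{\sqrt m}$ (that is, $\bar\psi(v,m)=\frac{2D^2L}{m}+\frac{2D\sqrt v}{\sqrt m}$ for all $v\ge0$, with a constant $D\ge0$), then the expected optimality gap is bounded by $$\frac{2bD^2L}{m}+\frac{2D\sigma}{\sqrt m}.$$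
   Context: **Problem.** Minimize $F(w)=\mathbb E_z[f(w,z)]$ over $w\in W$, given i.i.d. samples $z_1,z_2,\dots$ from a distribution on $\mathcal Z$. $F$ is finite on $W$ with $\nabla F(w)=\mathbb E_z[\nabla_wf(w,z)]$, and a minimizer $w^\star\in\arg\min_WF$ is assumed to exist. $\|\cdot\|$ is the Euclidean norm. $L$-smooth: $\|\nabla_w f(w,z)-\nabla_w f(w',z)\|\le L\|w-w'\|$ for all $z\in\mathcal Z$ and $w,w'\in W$. $v$-bounded variance: $\mathbb E_z\|\nabla_w f(w,z)-\nabla F(w)\|^2\le v$ for all $w\in W$. **Update rule and serial algorithm.** An update rule is a deterministic map $\phi$ taking an auxiliary state $a_j$, a vector $g_j\in\mathbb R^n$ and a parameter $\alpha_j$, and returning $(w_{j+1},a_{j+1})=\phi(a_j,g_j,\alpha_j)$ with $w_{j+1}\in W$; the initial $w_1\in W$ and $a_1$ are fixed. The parameter sequence may depend on the variance bound $v$; write it $(\alpha^{(v)}_j)$. The serial algorithm uses $g_j=\nabla_wf(w_j,z_j)$ at step $j$, and its output after $m$ samples is $\bar w_m=\frac1m\sum_{j=1}^mw_j$. **Serial optimality-gap bound.** "$\phi$ has expected optimality gap bounded by $\bar\psi$" means: for every $v\ge0$ and every loss $f':W\times\mathcal Z'\to\mathbb R$ with i.i.d. inputs on a sample space $\mathcal Z'$ such that $f'$ is convex and $L$-smooth in $w$, $\mathbb E_{z'}[f'(w,z')]=F(w)$ on $W$, and the gradients of $f'$ have $v$-bounded variance, the serial algorithm run on $f'$ with parameters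 $(\alpha_j^{(v)})$ satisfies $\mathbb E[F(\bar w_m)-F(w^\star)]\le\bar\psi(v,m)$ for all $m\ge1$. **DMB algorithm for stochastic optimization.** There are $k$ nodes and a batch size $b$ (a positive integer); $k$ divides $b$ and $b$ divides $m$. Let $r=m/b$. For $j=1,\dots,r$: each node receives $b/k$ fresh i.i.d. samples and computes the gradients $\nabla_wf(w_j,z)$ at the common point $w_j$; the average $\bar g_j$ of all $b$ gradients across the nodes is computed by a distributed vector-sum; then $(w_{j+1},a_{j+1})=\phi(a_j,\bar g_j,\alpha_j)$ with $\alpha_j=\alpha_j^{(\sigma^2/b)}$. The output is $\hat w=\frac1r\sum_{j=1}^rw_j$, and its expected optimality gap is $\mathbb E[F(\hat w)-F(w^\star)]$. *)

theory Defs
  imports "HOL-Probability.Probability"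
begin

text \<open>
  Losses live on \<open>W\<close> only, so gradients are taken within \<open>W\<close>. If \<open>W\<close> has empty interior, the
  gradient is not determined by the values on \<open>W\<close>; therefore a loss always comes together with
  its gradient field.
\<close>

definition is_gradient_on ::
  "(real ^ 'n) set \<Rightarrow> (real ^ 'n \<Rightarrow> real) \<Rightarrow> (real ^ 'n \<Rightarrow> real ^ 'n) \<Rightarrow> bool" where
  "is_gradient_on W h G \<longleftrightarrow> (\<forall>w\<in>W. (h has_derivative (\<lambda>d. d \<bullet> G w)) (at w within W))"

definition bounded_variance_on ::
  "(real ^ 'n) set \<Rightarrow> 'z measure \<Rightarrow> (real ^ 'n \<Rightarrow> 'z \<Rightarrow> real ^ 'n) \<Rightarrow> (real ^ 'n \<Rightarrow> real ^ 'n)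
    \<Rightarrow> real \<Rightarrow> bool" where
  "bounded_variance_on W M g gradF v \<longleftrightarrow>
     (\<forall>w\<in>W. g w \<in> borel_measurable M \<and>
            integrable M (\<lambda>z. (norm (g w z - gradF w))\<^sup>2) \<and>
            (LINT z|M. (norm (g w z - gradF w))\<^sup>2) \<le> v)"

text \<open>
  The loss \<open>f\<close> has sample space \<open>space M\<close>, sample distribution \<open>M\<close> and gradient field \<open>g\<close> in
  its first argument; \<open>gradF\<close> is the gradient field of the expected loss \<open>F\<close>.
\<close>

definition smooth_convex_loss ::
  "(real ^ 'n) set \<Rightarrow> real \<Rightarrow> (real ^ 'n \<Rightarrow> real) \<Rightarrow> (real ^ 'n \<Rightarrow> real ^ 'n) \<Rightarrow> real \<Rightarrow>
    'z measure \<Rightarrow> (real ^ 'n \<Rightarrow> 'z \<Rightarrow> real) \<Rightarrow> (real ^ 'n \<Rightarrow> 'z \<Rightarrow> real ^ 'n) \<Rightarrow> bool" where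
  "smooth_convex_loss W L F gradF v M f g \<longleftrightarrow>
     prob_space M \<and>
     (\<forall>z\<in>space M. convex_on W (\<lambda>w. f w z) \<and>
                   is_gradient_on W (\<lambda>w. f w z) (\<lambda>w. g w z) \<and>
                   L-lipschitz_on W (\<lambda>w. g w z)) \<and>
     (\<forall>w\<in>W. integrable M (f w) \<and> (LINT z|M. f w z) = F w) \<and>
     bounded_variance_on W M g gradF v"

text \<open>
  Rounds are numbered from \<open>0\<close>: \<open>iterate \<phi> \<alpha> w1 a1 G j\<close> is the pair of the \<open>(j+1)\<close>-st predictor
  and the \<open>(j+1)\<close>-st auxiliary state, where \<open>G j w\<close> is the gradient vector supplied in round
  \<open>j\<close> if the current predictor is \<open>w\<close>.
\<close>

primrec iterate ::
  "('a \<Rightarrow> real ^ 'n \<Rightarrow> 'p \<Rightarrow> (real ^ 'n) \<times> 'a) \<Rightarrow> (nat \<Rightarrow> 'p) \<Rightarrow> real ^ 'n \<Rightarrow> 'a \<Rightarrow>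
    (nat \<Rightarrow> real ^ 'n \<Rightarrow> real ^ 'n) \<Rightarrow> nat \<Rightarrow> (real ^ 'n) \<times> 'a" where
  "iterate \<phi> \<alpha> w1 a1 G 0 = (w1, a1)"
| "iterate \<phi> \<alpha> w1 a1 G (Suc j) =
     (case iterate \<phi> \<alpha> w1 a1 G j of (w, a) \<Rightarrow> \<phi> a (G j w) (\<alpha> j))"

definition averaged_iterate ::
  "('a \<Rightarrow> real ^ 'n \<Rightarrow> 'p \<Rightarrow> (real ^ 'n) \<times> 'a) \<Rightarrow> (nat \<Rightarrow> 'p) \<Rightarrow> real ^ 'n \<Rightarrow> 'a \<Rightarrow>
    (nat \<Rightarrow> real ^ 'n \<Rightarrow> real ^ 'n) \<Rightarrow> nat \<Rightarrow> real ^ 'n" where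
  "averaged_iterate \<phi> \<alpha> w1 a1 G r = (1 / real r) *\<^sub>R (\<Sum>j<r. fst (iterate \<phi> \<alpha> w1 a1 G j))"

definition serial_output ::
  "('a \<Rightarrow> real ^ 'n \<Rightarrow> 'p \<Rightarrow> (real ^ 'n) \<times> 'a) \<Rightarrow> (nat \<Rightarrow> 'p) \<Rightarrow> real ^ 'n \<Rightarrow> 'a \<Rightarrow>
    (real ^ 'n \<Rightarrow> 'z \<Rightarrow> real ^ 'n) \<Rightarrow> nat \<Rightarrow> (nat \<Rightarrow> 'z) \<Rightarrow> real ^ 'n" where
  "serial_output \<phi> \<alpha> w1 a1 g m z = averaged_iterate \<phi> \<alpha> w1 a1 (\<lambda>j w. g w (z j)) m"

text \<open>
  \<open>z (j, s, i)\<close> is the \<open>i\<close>-th of the \<open>b div k\<close> samples received by node \<open>s\<close> in round \<open>j\<close>.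
\<close>

definition dmb_gradient ::
  "(real ^ 'n \<Rightarrow> 'z \<Rightarrow> real ^ 'n) \<Rightarrow> nat \<Rightarrow> nat \<Rightarrow> (nat \<times> nat \<times> nat \<Rightarrow> 'z) \<Rightarrow>
    nat \<Rightarrow> real ^ 'n \<Rightarrow> real ^ 'n" where
  "dmb_gradient g k b z j w = (1 / real b) *\<^sub>R (\<Sum>s<k. \<Sum>i<b div k. g w (z (j, s, i)))"

definition dmb_output ::
  "('a \<Rightarrow> real ^ 'n \<Rightarrow> 'p \<Rightarrow> (real ^ 'n) \<times> 'a) \<Rightarrow> (nat \<Rightarrow> 'p) \<Rightarrow> real ^ 'n \<Rightarrow> 'a \<Rightarrow>
    (real ^ 'n \<Rightarrow> 'z \<Rightarrow> real ^ 'n) \<Rightarrow> nat \<Rightarrow> nat \<Rightarrow> nat \<Rightarrow> (nat \<times> nat \<times> nat \<Rightarrow> 'z) \<Rightarrow> real ^ 'n" where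
  "dmb_output \<phi> \<alpha> w1 a1 g k b m z =
     averaged_iterate \<phi> \<alpha> w1 a1 (dmb_gradient g k b z) (m div b)"

definition dmb_samples :: "'z measure \<Rightarrow> nat \<Rightarrow> nat \<Rightarrow> nat \<Rightarrow> (nat \<times> nat \<times> nat \<Rightarrow> 'z) measure" where
  "dmb_samples M k b m = PiM ({..<m div b} \<times> {..<k} \<times> {..<b div k}) (\<lambda>_. M)"

text \<open>
  The Bochner integral of a non-integrable function is \<open>0\<close>, so the existence of the expectation
  is part of the bound.
\<close>

definition expected_gap_le ::
  "'s measure \<Rightarrow> (real ^ 'n \<Rightarrow> real) \<Rightarrow> real ^ 'n \<Rightarrow> ('s \<Rightarrow> real ^ 'n) \<Rightarrow> real \<Rightarrow> bool" where
  "expected_gap_le P F wstar X B \<longleftrightarrow>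
     integrable P (\<lambda>\<omega>. F (X \<omega>) - F wstar) \<and> (LINT \<omega>|P. F (X \<omega>) - F wstar) \<le> B"

text \<open>
  The losses \<open>f'\<close> range over all probability spaces over the type given by the first argument
  (a quantification over the type itself is not available); assuming the bound for one type is
  weaker than assuming it for all sample spaces.
\<close>

definition serial_gap_bounded ::
  "'y itself \<Rightarrow> (real ^ 'n) set \<Rightarrow> real \<Rightarrow> (real ^ 'n \<Rightarrow> real) \<Rightarrow> (real ^ 'n \<Rightarrow> real ^ 'n) \<Rightarrow>
    real ^ 'n \<Rightarrow> ('a \<Rightarrow> real ^ 'n \<Rightarrow> 'p \<Rightarrow> (real ^ 'n) \<times> 'a) \<Rightarrow> (real \<Rightarrow> nat \<Rightarrow> 'p) \<Rightarrow>
    real ^ 'n \<Rightarrow> 'a \<Rightarrow> (real \<Rightarrow> nat \<Rightarrow> real) \<Rightarrow> bool" where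
  "serial_gap_bounded _ W L F gradF wstar \<phi> \<alpha> w1 a1 \<psi> \<longleftrightarrow>
     (\<forall>v\<ge>0. \<forall>(N :: 'y measure) f' g'. smooth_convex_loss W L F gradF v N f' g' \<longrightarrow>
        (\<forall>m\<ge>1. expected_gap_le (PiM {..<m} (\<lambda>_. N)) F wstar
                  (serial_output \<phi> (\<alpha> v) w1 a1 g' m) (\<psi> v m)))"

end

theory Submission imports Defs
begin

text \<open>
  Averaging the \<open>b\<close> losses of a batch gives a loss on the \<open>b\<close>-fold product sample space that is again
  convex and \<open>L\<close>-smooth with expectation \<open>F\<close>, and independence makes the cross terms vanish, so that
  its gradients have \<open>\<sigma>\<^sup>2 / b\<close>-bounded variance. Up to regrouping the samples into
  batches, the DMB algorithm is the serial algorithm run on this loss for \<open>m / b\<close> steps.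
\<close>

text \<open>The value type is left open so that one definition serves for the real-valued loss and
  for its vector-valued gradient field.\<close>

definition batch_average :: "nat \<Rightarrow> ('w \<Rightarrow> 'z \<Rightarrow> 'v) \<Rightarrow> 'w \<Rightarrow> (nat \<Rightarrow> 'z) \<Rightarrow> 'v::real_vector" where
  "batch_average b h w y = (1 / real b) *\<^sub>R (\<Sum>i<b. h w (y i))"

text \<open>The restrictions place the result in the iterated product space, whose points are
  \<open>undefined\<close> outside the index sets. Here \<open>c\<close> is the number of samples
  per node, and a batch lists the nodes one after another.\<close>

definition group_samples :: "nat \<Rightarrow> nat \<Rightarrow> nat \<Rightarrow> (nat \<times> nat \<times> nat \<Rightarrow> 'z) \<Rightarrow> nat \<Rightarrow> nat \<Rightarrow> 'z" where
  "group_samples r b c z = (\<lambda>j\<in>{..<r}. \<lambda>l\<in>{..<b}. z (j, l div c, l mod c))"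

subsection \<open>Moments of functions of independent samples\<close>

lemma
  fixes h :: "'z \<Rightarrow> 'b::{banach, second_countable_topology}"
  assumes "prob_space M" "i \<in> I" "integrable M h"
  shows integrable_PiM_component: "integrable (PiM I (\<lambda>_. M)) (\<lambda>y. h (y i))"
    and integral_PiM_component: "(LINT y|PiM I (\<lambda>_. M). h (y i)) = integral\<^sup>L M h"
proof -
  have D: "distr (PiM I (\<lambda>_. M)) M (\<lambda>y. y i) = M"
    using distr_PiM_component[of I "\<lambda>_. M" i] assms by simp
  have meas: "(\<lambda>y. y i) \<in> measurable (PiM I (\<lambda>_. M)) M"
    using assms by simp
  show "integrable (PiM I (\<lambda>_. M)) (\<lambda>y. h (y i))"
    using integrable_distr[OF meas, of h] D assms by simp
  show "(LINT y|PiM I (\<lambda>_. M). h (y i)) = integral\<^sup>L M h"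
    using integral_distr[OF meas, of h] D assms by simp
qed

lemma
  fixes h h' :: "'z \<Rightarrow> real"
  assumes "prob_space M" "finite I" "i \<in> I" "j \<in> I" "i \<noteq> j"
    and "integrable M h" "integrable M h'"
  shows integrable_PiM_two_components:
      "integrable (PiM I (\<lambda>_. M)) (\<lambda>y. h (y i) * h' (y j))"
    and integral_PiM_two_components:
      "(LINT y|PiM I (\<lambda>_. M). h (y i) * h' (y j)) = integral\<^sup>L M h * integral\<^sup>L M h'"
proof -
  interpret M: prob_space M by fact
  interpret product_prob_space "\<lambda>_. M" I ..
  \<comment> \<open>Padding with the constant \<open>1\<close>, whose integral is \<open>1\<close>
    under a probability measure, turns the two factors into a product over all of \<open>I\<close>,
    so that integration factor by factor applies.\<close>
  define H where "H = (\<lambda>l. if l = i then h else if l = j then h' else (\<lambda>_. 1))"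
  have H: "integrable M (H l)" for l
    using assms by (simp add: H_def)
  have split: "prod q I = q i * (q j * prod q (I - {i} - {j}))" for q :: "_ \<Rightarrow> real"
    using assms by (simp add: prod.remove[of I i] prod.remove[of "I - {i}" j])
  have "(\<Prod>l\<in>I. H l (y l)) = h (y i) * h' (y j)" for y
    using assms by (simp add: split H_def)
  moreover have "(\<Prod>l\<in>I. integral\<^sup>L M (H l)) = integral\<^sup>L M h * integral\<^sup>L M h'"
    using assms by (simp add: split H_def M.prob_space)
  ultimately show "integrable (PiM I (\<lambda>_. M)) (\<lambda>y. h (y i) * h' (y j))"
      "(LINT y|PiM I (\<lambda>_. M). h (y i) * h' (y j)) = integral\<^sup>L M h * integral\<^sup>L M h'"
    using product_integrable_prod[of I H] product_integral_prod[of I H] H assms by simp_all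
qed

text \<open>The inner product is a finite sum over coordinates. Each summand is a product of
  functions of two different samples, so its expectation factors into coordinate means, which are
  \<open>0\<close>.\<close>

lemma
  fixes X :: "'z \<Rightarrow> 'v::euclidean_space"
  assumes "prob_space M" "finite I" "i \<in> I" "j \<in> I" "i \<noteq> j"
    and X: "integrable M X" "integral\<^sup>L M X = 0"
  shows integrable_inner_PiM_components:
      "integrable (PiM I (\<lambda>_. M)) (\<lambda>y. X (y i) \<bullet> X (y j))"
    and integral_inner_PiM_components:
      "(LINT y|PiM I (\<lambda>_. M). X (y i) \<bullet> X (y j)) = 0"
proof -
  have c: "integrable M (\<lambda>z. X z \<bullet> e)" "(LINT z|M. X z \<bullet> e) = 0" for e
    using X by simp_all
  have p: "integrable (PiM I (\<lambda>_. M)) (\<lambda>y. (X (y i) \<bullet> e) * (X (y j) \<bullet> e))"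
      "(LINT y|PiM I (\<lambda>_. M). (X (y i) \<bullet> e) * (X (y j) \<bullet> e)) = 0" for e
    using integrable_PiM_two_components[OF assms(1-5) c(1) c(1)]
      integral_PiM_two_components[OF assms(1-5) c(1) c(1)] c(2) by simp_all
  show "integrable (PiM I (\<lambda>_. M)) (\<lambda>y. X (y i) \<bullet> X (y j))"
    unfolding euclidean_inner[of "X _" "X _"] by (intro Bochner_Integration.integrable_sum p)
  show "(LINT y|PiM I (\<lambda>_. M). X (y i) \<bullet> X (y j)) = 0"
    unfolding euclidean_inner[of "X _" "X _"]
    by (subst Bochner_Integration.integral_sum) (simp_all add: p)
qed

text \<open>Expanding the square gives a double sum in which only the diagonal survives. The factor
  is therefore \<open>card I\<close> and not its square.\<close>

lemma
  fixes X :: "'z \<Rightarrow> 'v::euclidean_space"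
  assumes M: "prob_space M" and I: "finite I"
    and X: "integrable M X" "integral\<^sup>L M X = 0" and X2: "integrable M (\<lambda>z. (norm (X z))\<^sup>2)"
  shows integrable_norm_sum_PiM_squared:
      "integrable (PiM I (\<lambda>_. M)) (\<lambda>y. (norm (\<Sum>i\<in>I. X (y i)))\<^sup>2)"
    and integral_norm_sum_PiM_squared:
      "(LINT y|PiM I (\<lambda>_. M). (norm (\<Sum>i\<in>I. X (y i)))\<^sup>2) = real (card I) * (LINT z|M. (norm (X z))\<^sup>2)"
proof -
  have expand: "(norm (\<Sum>i\<in>I. X (y i)))\<^sup>2 = (\<Sum>i\<in>I. \<Sum>j\<in>I. X (y i) \<bullet> X (y j))" for y
    by (simp add: power2_norm_eq_inner inner_sum_left) (simp add: inner_sum_right)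
  have int: "integrable (PiM I (\<lambda>_. M)) (\<lambda>y. X (y i) \<bullet> X (y j))" if "i \<in> I" "j \<in> I" for i j
    using integrable_inner_PiM_components[OF M I that _ X] integrable_PiM_component[OF M that(1) X2]
    by (cases "i = j") (simp_all add: power2_norm_eq_inner)
  have val: "(LINT y|PiM I (\<lambda>_. M). X (y i) \<bullet> X (y j)) = (if j = i then (LINT z|M. (norm (X z))\<^sup>2) else 0)"
    if "i \<in> I" "j \<in> I" for i j
    using integral_inner_PiM_components[OF M I that _ X] integral_PiM_component[OF M that(1) X2]
    by (cases "i = j") (simp_all add: power2_norm_eq_inner)
  show "integrable (PiM I (\<lambda>_. M)) (\<lambda>y. (norm (\<Sum>i\<in>I. X (y i)))\<^sup>2)"
    unfolding expand by (intro Bochner_Integration.integrable_sum int)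
  have "(LINT y|PiM I (\<lambda>_. M). (norm (\<Sum>i\<in>I. X (y i)))\<^sup>2)
      = (\<Sum>i\<in>I. \<Sum>j\<in>I. LINT y|PiM I (\<lambda>_. M). X (y i) \<bullet> X (y j))"
    unfolding expand using int by (simp add: Bochner_Integration.integral_sum)
  also have "\<dots> = (\<Sum>i\<in>I. \<Sum>j\<in>I. if j = i then (LINT z|M. (norm (X z))\<^sup>2) else 0)"
    by (intro sum.cong refl val)
  also have "\<dots> = real (card I) * (LINT z|M. (norm (X z))\<^sup>2)"
    using I by simp
  finally show "(LINT y|PiM I (\<lambda>_. M). (norm (\<Sum>i\<in>I. X (y i)))\<^sup>2)
      = real (card I) * (LINT z|M. (norm (X z))\<^sup>2)" .
qed

subsection \<open>The averaged loss\<close>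

lemma batch_average_diff:
  assumes "b > 0"
  shows "batch_average b h w y - u = (1 / real b) *\<^sub>R (\<Sum>i<b. h w (y i) - u)"
  using assms by (simp add: batch_average_def sum_subtractf scaleR_diff_right sum_constant_scaleR)

lemma convex_on_batch_average:
  fixes h :: "'w::real_vector \<Rightarrow> 'z \<Rightarrow> real"
  assumes "convex W" "\<And>i. i < b \<Longrightarrow> convex_on W (\<lambda>w. h w (y i))"
  shows "convex_on W (\<lambda>w. batch_average b h w y)"
proof -
  have "convex_on W (\<lambda>w. \<Sum>i<n. h w (y i))" if "n \<le> b" for n
    using that
  proof (induction n)
    case 0
    \<comment> \<open>Convexity of a function on \<open>W\<close> includes convexity of the set
      \<open>W\<close>, which the empty sum cannot inherit from a summand.\<close>
    then show ?case using assms(1) by (simp add: convex_on_def)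
  next
    case (Suc n)
    then show ?case using assms(2)[of n] by (simp add: convex_on_add)
  qed
  then show ?thesis
    unfolding batch_average_def real_scaleR_def by (intro convex_on_cmul) simp_all
qed

lemma is_gradient_on_batch_average:
  assumes "\<And>i. i < b \<Longrightarrow> is_gradient_on W (\<lambda>w. f w (y i)) (\<lambda>w. g w (y i))"
  shows "is_gradient_on W (\<lambda>w. batch_average b f w y) (\<lambda>w. batch_average b g w y)"
  unfolding is_gradient_on_def
proof
  fix w assume "w \<in> W"
  then have "((\<lambda>w. f w (y i)) has_derivative (\<lambda>d. d \<bullet> g w (y i))) (at w within W)" if "i < b" for i
    using assms that unfolding is_gradient_on_def by blast
  then have "((\<lambda>w. (1 / real b) *\<^sub>R (\<Sum>i<b. f w (y i))) has_derivative
      (\<lambda>d. (1 / real b) *\<^sub>R (\<Sum>i<b. d \<bullet> g w (y i)))) (at w within W)"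
    by (intro has_derivative_scaleR_right has_derivative_sum) simp
  then show "((\<lambda>w. batch_average b f w y) has_derivative (\<lambda>d. d \<bullet> batch_average b g w y)) (at w within W)"
    by (simp add: batch_average_def inner_sum_right)
qed

lemma lipschitz_on_batch_average:
  fixes g :: "'w::real_normed_vector \<Rightarrow> 'z \<Rightarrow> 'v::real_normed_vector"
  assumes "b > 0" "\<And>i. i < b \<Longrightarrow> L-lipschitz_on W (\<lambda>w. g w (y i))"
  shows "L-lipschitz_on W (\<lambda>w. batch_average b g w y)"
proof (rule lipschitz_onI)
  \<comment> \<open>A Lipschitz constant is nonnegative by definition; \<open>b > 0\<close>
    guarantees a summand to read this from.\<close>
  show "0 \<le> L"
    using assms lipschitz_on_nonneg by blast
  fix u w assume "u \<in> W" "w \<in> W"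
  then have "norm (\<Sum>i<b. g u (y i) - g w (y i)) \<le> (\<Sum>i<b. L * norm (u - w))"
    by (intro sum_norm_le lipschitz_on_normD[OF assms(2)]) auto
  then have "norm (\<Sum>i<b. g u (y i) - g w (y i)) / real b \<le> L * norm (u - w)"
    using assms(1) by (simp add: field_simps)
  then show "dist (batch_average b g u y) (batch_average b g w y) \<le> L * dist u w"
    by (simp add: batch_average_def dist_norm sum_subtractf flip: scaleR_diff_right)
qed

text \<open>The deviation from \<open>gradF w\<close> is \<open>1 / b\<close> times a sum of
  \<open>b\<close> independent centred terms. The sum contributes a factor \<open>b\<close> and the
  square of the prefactor contributes \<open>1 / b^2\<close>, which leaves
  \<open>v / b\<close>.\<close>

lemma bounded_variance_on_batch_average:
  assumes M: "prob_space M" and b: "b > 0"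
    and mean: "\<And>w. w \<in> W \<Longrightarrow> integrable M (g w) \<and> (LINT z|M. g w z) = gradF w"
    and var: "bounded_variance_on W M g gradF v"
  shows "bounded_variance_on W (PiM {..<b} (\<lambda>_. M)) (batch_average b g) gradF (v / real b)"
  unfolding bounded_variance_on_def
proof (intro ballI)
  fix w assume w: "w \<in> W"
  interpret M: prob_space M by fact
  define X where "X = (\<lambda>z. g w z - gradF w)"
  have X: "integrable M X" "integral\<^sup>L M X = 0"
    using mean[OF w] by (simp_all add: X_def M.prob_space)
  have X2: "integrable M (\<lambda>z. (norm (X z))\<^sup>2)" "(LINT z|M. (norm (X z))\<^sup>2) \<le> v"
    using var w by (simp_all add: bounded_variance_on_def X_def)
  have [measurable]: "g w \<in> borel_measurable M"
    using mean[OF w] by auto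
  have eq: "(norm (batch_average b g w y - gradF w))\<^sup>2 = (norm (\<Sum>i<b. X (y i)))\<^sup>2 / (real b)\<^sup>2" for y
    using b by (simp add: batch_average_diff X_def power_divide)
  have "real b * (LINT z|M. (norm (X z))\<^sup>2) / (real b)\<^sup>2 \<le> v / real b"
    using X2(2) b by (simp add: power2_eq_square divide_right_mono)
  moreover have "(batch_average b g w) \<in> borel_measurable (PiM {..<b} (\<lambda>_. M))"
    unfolding batch_average_def[abs_def] by measurable
  ultimately show "batch_average b g w \<in> borel_measurable (PiM {..<b} (\<lambda>_. M)) \<and>
      integrable (PiM {..<b} (\<lambda>_. M)) (\<lambda>y. (norm (batch_average b g w y - gradF w))\<^sup>2) \<and>
      (LINT y|PiM {..<b} (\<lambda>_. M). (norm (batch_average b g w y - gradF w))\<^sup>2) \<le> v / real b"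
    using integrable_norm_sum_PiM_squared[OF M _ X X2(1), of "{..<b}"]
      integral_norm_sum_PiM_squared[OF M _ X X2(1), of "{..<b}"]
    by (simp add: eq)
qed

text \<open>This makes the averaged loss one of the losses over which
  \<open>serial_gap_bounded\<close> quantifies, with the same \<open>L\<close> and \<open>F\<close>
  but a smaller variance parameter.\<close>

lemma smooth_convex_loss_batch_average:
  assumes loss: "smooth_convex_loss W L F gradF v M f g" and W: "convex W" and b: "b > 0"
    and mean: "\<And>w. w \<in> W \<Longrightarrow> integrable M (g w) \<and> (LINT z|M. g w z) = gradF w"
  shows "smooth_convex_loss W L F gradF (v / real b) (PiM {..<b} (\<lambda>_. M))
    (batch_average b f) (batch_average b g)"
proof -
  have M: "prob_space M"
    using loss by (simp add: smooth_convex_loss_def)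
  have "integrable (PiM {..<b} (\<lambda>_. M)) (batch_average b f w) \<and>
      (LINT y|PiM {..<b} (\<lambda>_. M). batch_average b f w y) = F w" if "w \<in> W" for w
  proof -
    have fw: "integrable M (f w)" "integral\<^sup>L M (f w) = F w"
      using loss that by (simp_all add: smooth_convex_loss_def)
    have "integrable (PiM {..<b} (\<lambda>_. M)) (\<lambda>y. f w (y i))"
        "(LINT y|PiM {..<b} (\<lambda>_. M). f w (y i)) = F w" if "i < b" for i
      using integrable_PiM_component[OF M _ fw(1), of i "{..<b}"]
        integral_PiM_component[OF M _ fw(1), of i "{..<b}"] that fw(2) by simp_all
    then show ?thesis
      using b unfolding batch_average_def[abs_def]
      by (auto intro!: Bochner_Integration.integrable_sum integrable_mult_right)
  qed
  \<comment> \<open>Convexity, gradients and smoothness are given only for sample points in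
    \<open>space M\<close>, so the entries of a batch must be located there.\<close>
  moreover have "y i \<in> space M" if "y \<in> space (PiM {..<b} (\<lambda>_. M))" "i < b" for y i
    using that by (auto simp: space_PiM)
  ultimately show ?thesis
    using loss unfolding smooth_convex_loss_def
    by (auto intro!: prob_space_PiM convex_on_batch_average[OF W] is_gradient_on_batch_average
        lipschitz_on_batch_average[OF b] bounded_variance_on_batch_average[OF M b mean])
qed

subsection \<open>Regrouping the samples into batches\<close>

text \<open>Independence means that the joint law is the product of the marginals. The joint law of
  all coordinates is the product measure itself, and each marginal is \<open>M\<close>.\<close>

lemma (in prob_space) indep_vars_PiM_components:
  assumes "finite I" "I \<noteq> {}"
  shows "prob_space.indep_vars (PiM I (\<lambda>_. M)) (\<lambda>_. M) (\<lambda>i z. z i) I"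
proof -
  interpret P: prob_space "PiM I (\<lambda>_. M)"
    by (intro prob_space_PiM prob_space_axioms)
  have "distr (PiM I (\<lambda>_. M)) (PiM I (\<lambda>_. M)) (\<lambda>z. \<lambda>i\<in>I. z i) = PiM I (\<lambda>_. M)"
    using distr_PiM_reindex[of I "\<lambda>_. M" "\<lambda>i. i" I] prob_space_axioms by simp
  also have "\<dots> = PiM I (\<lambda>i. distr (PiM I (\<lambda>_. M)) M (\<lambda>z. z i))"
    by (intro PiM_cong refl distr_PiM_component[symmetric] prob_space_axioms)
  finally show ?thesis
    using assms by (subst P.indep_vars_iff_distr_eq_PiM') simp_all
qed

text \<open>Division with remainder, inverted by \<open>s * c + i\<close>. For \<open>c = 0\<close>
  both sides are empty.\<close>

lemma bij_betw_div_mod: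
  "bij_betw (\<lambda>l. (l div c, l mod c)) {..<k * c} ({..<k} \<times> {..<c::nat})"
proof (cases "c = 0")
  case False
  show ?thesis
  proof (rule bij_betw_byWitness[where f' = "\<lambda>(s, i). s * c + i"])
    show "(\<lambda>l. (l div c, l mod c)) ` {..<k * c} \<subseteq> {..<k} \<times> {..<c}"
      using False by (auto simp: less_mult_imp_div_less)
    show "(\<lambda>(s, i). s * c + i) ` ({..<k} \<times> {..<c}) \<subseteq> {..<k * c}"
    proof -
      have "s * c + i < k * c" if "s < k" "i < c" for s i
        using that mult_le_mono1[of "Suc s" k c] by auto
      then show ?thesis by auto
    qed
  qed auto
qed (auto simp: bij_betw_def)

text \<open>Different rounds read disjoint blocks of coordinates, so the batches are independent,
  and each batch is an injective reindexing of coordinates, so its law is the \<open>b\<close>-fold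
  product. Hence the regrouped samples are \<open>r\<close> i.i.d. batches.\<close>

lemma
  assumes M: "prob_space M" and r: "r > 0" and b: "k * c = b" "b > 0"
  defines "P \<equiv> PiM ({..<r} \<times> {..<k} \<times> {..<c}) (\<lambda>_. M)"
    and "Q \<equiv> PiM {..<r} (\<lambda>_. PiM {..<b} (\<lambda>_. M))"
  shows measurable_group_samples: "group_samples r b c \<in> measurable P Q"
    and distr_group_samples: "distr P Q (group_samples r b c) = Q"
proof -
  interpret M: prob_space M by fact
  let ?I = "{..<r} \<times> {..<k} \<times> {..<c}"
  have kc: "k > 0" "c > 0" using b by auto
  interpret P: prob_space P
    unfolding P_def by (intro prob_space_PiM M)
  let ?N = "PiM {..<b} (\<lambda>_. M)"
  define K where "K j = {j} \<times> {..<k} \<times> {..<c}" for j :: nat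
  define e where "e j l = (j, l div c, l mod c)" for j l :: nat
  define U where "U j z = (\<lambda>l\<in>{..<b}. z (e j l))" for j and z :: "nat \<times> nat \<times> nat \<Rightarrow> 'a"
  have bij: "bij_betw (\<lambda>l. (l div c, l mod c)) {..<b} ({..<k} \<times> {..<c})"
    using bij_betw_div_mod b by blast
  have eK: "e j l \<in> K j" if "l < b" for j l
    using bij_betwE[OF bij] that by (auto simp: e_def K_def)
  have inj: "inj_on (e j) {..<b}" for j
    using bij_betw_imp_inj_on[OF bij] by (auto simp: e_def inj_on_def)
  have KI: "K j \<subseteq> ?I" if "j < r" for j
    using that by (auto simp: K_def)
  \<comment> \<open>The index set \<open>J\<close> is kept general for two uses: the single block
    \<open>K j\<close>, for independence, and the whole index set, for measurability on
    \<open>P\<close>.\<close>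
  have U_meas: "U j \<in> measurable (PiM J (\<lambda>_. M)) ?N" if "K j \<subseteq> J" for j J
    unfolding U_def using that eK by (intro measurable_restrict measurable_component_singleton) auto
  have U_distr: "distr P ?N (U j) = ?N" if "j < r" for j
  proof -
    have "e j \<in> {..<b} \<rightarrow> ?I"
      using KI[OF that] eK by auto
    from distr_PiM_reindex[of ?I "\<lambda>_. M", OF M inj this] show ?thesis
      unfolding P_def U_def .
  qed
  have "P.indep_vars (\<lambda>_. M) (\<lambda>i z. z i) ?I"
    unfolding P_def using r kc by (intro M.indep_vars_PiM_components) auto
  then have "P.indep_vars (\<lambda>j. PiM (K j) (\<lambda>_. M)) (\<lambda>j z. restrict z (K j)) {..<r}"
    by (rule P.indep_vars_restrict) (use KI in \<open>auto simp: K_def disjoint_family_on_def\<close>)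
  then have "P.indep_vars (\<lambda>_. ?N) (\<lambda>j z. U j (restrict z (K j))) {..<r}"
    by (rule P.indep_vars_compose2) (simp add: U_meas)
  moreover have "U j (restrict z (K j)) = U j z" for j z
    using eK by (auto simp: U_def intro!: restrict_ext)
  ultimately have indep: "P.indep_vars (\<lambda>_. ?N) U {..<r}"
    by simp
  have group: "group_samples r b c = (\<lambda>z. \<lambda>j\<in>{..<r}. U j z)"
    by (simp add: group_samples_def U_def e_def fun_eq_iff)
  have meas: "U j \<in> measurable P ?N" if "j < r" for j
    using U_meas[OF KI[OF that]] by (simp add: P_def)
  then show "group_samples r b c \<in> measurable P Q"
    unfolding group Q_def by (intro measurable_restrict) simp
  have "distr P Q (group_samples r b c) = PiM {..<r} (\<lambda>j. distr P ?N (U j))"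
    using indep r meas P.indep_vars_iff_distr_eq_PiM'[of "{..<r}" U "\<lambda>_. ?N"]
    by (auto simp: group Q_def)
  also have "\<dots> = Q"
    unfolding Q_def by (intro PiM_cong refl) (simp add: U_distr)
  finally show "distr P Q (group_samples r b c) = Q" .
qed

section \<open>Comparison of the DMB run with the serial run on batches\<close>

lemma dmb_gradient_group_samples:
  assumes "k * c = b" "b > 0" "j < r"
  shows "dmb_gradient g k b z j w = batch_average b g w (group_samples r b c z j)"
proof -
  have "b div k = c" using assms by auto
  then have "(\<Sum>s<k. \<Sum>i<b div k. g w (z (j, s, i))) = (\<Sum>(s, i)\<in>{..<k} \<times> {..<c}. g w (z (j, s, i)))"
    by (simp add: sum.cartesian_product)
  also have "\<dots> = (\<Sum>l<b. g w (z (j, l div c, l mod c)))"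
    using sum.reindex_bij_betw[OF bij_betw_div_mod[of c k],
        of "\<lambda>(s, i). g w (z (j, s, i))"] assms(1) by simp
  finally show ?thesis
    using assms(3) by (simp add: dmb_gradient_def batch_average_def group_samples_def)
qed

lemma iterate_cong:
  assumes "\<And>i w. i < j \<Longrightarrow> G i w = H i w"
  shows "iterate \<phi> \<alpha> w1 a1 G j = iterate \<phi> \<alpha> w1 a1 H j"
  using assms by (induction j) (auto split: prod.split)

text \<open>The equality holds for every sample point, not just in law. Iterate \<open>j\<close>
  consults only rounds before \<open>j\<close>, and for \<open>j < m div b\<close> these all lie in
  the range where the regrouped batches are defined.\<close>

lemma dmb_output_eq_serial_output:
  assumes "k * c = b" "b > 0"
  shows "dmb_output \<phi> \<alpha> w1 a1 g k b m z =
    serial_output \<phi> \<alpha> w1 a1 (batch_average b g) (m div b) (group_samples (m div b) b c z)"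
proof -
  have "iterate \<phi> \<alpha> w1 a1 (dmb_gradient g k b z) j =
      iterate \<phi> \<alpha> w1 a1 (\<lambda>j w. batch_average b g w (group_samples (m div b) b c z j)) j"
    if "j < m div b" for j
    using that by (intro iterate_cong dmb_gradient_group_samples assms) simp
  then show ?thesis
    by (simp add: dmb_output_def serial_output_def averaged_iterate_def)
qed

text \<open>Change of variables for the gap, carrying its integrability along with the
  bound.\<close>

lemma expected_gap_le_distr:
  assumes "T \<in> measurable P Q" "expected_gap_le (distr P Q T) F wstar X B"
  shows "expected_gap_le P F wstar (\<lambda>\<omega>. X (T \<omega>)) B"
proof -
  have int: "integrable (distr P Q T) (\<lambda>\<omega>. F (X \<omega>) - F wstar)"
    using assms(2) by (simp add: expected_gap_le_def)
  \<comment> \<open>Measurability of the gap, required for the transfer of the integral, is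
    extracted from its integrability under the image law.\<close>
  then have "(\<lambda>\<omega>. F (X \<omega>) - F wstar) \<in> borel_measurable Q"
    by (simp add: integrable_iff_bounded)
  then show ?thesis
    using assms(2) integrable_distr[OF assms(1) int] integral_distr[OF assms(1), of "\<lambda>\<omega>. F (X \<omega>) - F wstar"]
    unfolding expected_gap_le_def by simp
qed

theorem theorem5:
  fixes W :: "(real ^ 'n) set"
    and M :: "'z measure"
    and f :: "real ^ 'n \<Rightarrow> 'z \<Rightarrow> real"
    and g :: "real ^ 'n \<Rightarrow> 'z \<Rightarrow> real ^ 'n"
    and F :: "real ^ 'n \<Rightarrow> real"
    and gradF :: "real ^ 'n \<Rightarrow> real ^ 'n"
    and \<phi> :: "'a \<Rightarrow> real ^ 'n \<Rightarrow> 'p \<Rightarrow> (real ^ 'n) \<times> 'a"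
    and \<alpha> :: "real \<Rightarrow> nat \<Rightarrow> 'p"
    and w1 wstar :: "real ^ 'n" and a1 :: 'a
    and \<psi> :: "real \<Rightarrow> nat \<Rightarrow> real"
    and L \<sigma> :: real and k b m :: nat
  assumes "closed W" and "convex W"
    and "\<sigma> \<ge> 0"
    and "smooth_convex_loss W L F gradF (\<sigma>\<^sup>2) M f g"
    and "is_gradient_on W F gradF"
    and "\<And>w. w \<in> W \<Longrightarrow> integrable M (g w) \<and> (LINT z|M. g w z) = gradF w"
    and "is_arg_min F (\<lambda>w. w \<in> W) wstar"
    and "\<And>a d p. fst (\<phi> a d p) \<in> W"
    and "w1 \<in> W"
    and "serial_gap_bounded TYPE(nat \<Rightarrow> 'z) W L F gradF wstar \<phi> \<alpha> w1 a1 \<psi>"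
    and "b > 0" and "k dvd b" and "b dvd m" and "m > 0"
  shows "expected_gap_le (dmb_samples M k b m) F wstar
           (dmb_output \<phi> (\<alpha> (\<sigma>\<^sup>2 / real b)) w1 a1 g k b m)
           (\<psi> (\<sigma>\<^sup>2 / real b) (m div b))
       \<and> (\<forall>D\<ge>0. (\<forall>v\<ge>0. \<forall>n\<ge>1. \<psi> v n = 2 * D\<^sup>2 * L / real n + 2 * D * sqrt v / sqrt (real n)) \<longrightarrow>
           expected_gap_le (dmb_samples M k b m) F wstar
             (dmb_output \<phi> (\<alpha> (\<sigma>\<^sup>2 / real b)) w1 a1 g k b m)
             (2 * real b * D\<^sup>2 * L / real m + 2 * D * \<sigma> / sqrt (real m)))"
proof -
  define r where "r = m div b"
  define c where "c = b div k"
  have r: "r > 0" and m: "real m = real b * real r"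
    using \<open>b > 0\<close> \<open>b dvd m\<close> \<open>m > 0\<close> by (auto simp: r_def dvd_def)
  have kc: "k * c = b"
    using \<open>k dvd b\<close> by (simp add: c_def)
  let ?N = "PiM {..<b} (\<lambda>_. M)"
  have M: "prob_space M"
    using assms(4) by (simp add: smooth_convex_loss_def)
  have loss: "smooth_convex_loss W L F gradF (\<sigma>\<^sup>2 / real b) ?N (batch_average b f) (batch_average b g)"
    by (rule smooth_convex_loss_batch_average[OF assms(4,2) \<open>b > 0\<close> assms(6)])
  \<comment> \<open>A batch is a single sample of type \<open>nat \<Rightarrow> 'z\<close>. The
    serial bound is taken at variance \<open>\<sigma>\<^sup>2 / b\<close>, which selects exactly the
    parameter sequence of the DMB run; \<open>r > 0\<close> meets its demand for at least one
    sample.\<close>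
  have "expected_gap_le (PiM {..<r} (\<lambda>_. ?N)) F wstar
      (serial_output \<phi> (\<alpha> (\<sigma>\<^sup>2 / real b)) w1 a1 (batch_average b g) r) (\<psi> (\<sigma>\<^sup>2 / real b) r)"
    using assms(10) loss r unfolding serial_gap_bounded_def by simp
  \<comment> \<open>The law of \<open>r\<close> i.i.d. batches is the image of
    \<open>dmb_samples\<close> under regrouping, so the bound pulls back to the original
    samples.\<close>
  then have gap: "expected_gap_le (dmb_samples M k b m) F wstar
      (dmb_output \<phi> (\<alpha> (\<sigma>\<^sup>2 / real b)) w1 a1 g k b m) (\<psi> (\<sigma>\<^sup>2 / real b) r)"
    using expected_gap_le_distr[OF measurable_group_samples[OF M r kc \<open>b > 0\<close>]]
      distr_group_samples[OF M r kc \<open>b > 0\<close>]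
    unfolding dmb_samples_def dmb_output_eq_serial_output[OF kc \<open>b > 0\<close>, abs_def] r_def[symmetric] c_def[symmetric]
    by simp
  \<comment> \<open>With \<open>m = b * r\<close>, the first term gains the factor \<open>b\<close>,
    while in the second the \<open>b\<close> from the variance combines with \<open>r\<close> to
    give \<open>sqrt m\<close>; \<open>\<sigma> \<ge> 0\<close> gives
    \<open>sqrt (\<sigma>\<^sup>2) = \<sigma>\<close>.\<close>
  have "2 * D\<^sup>2 * L / real r + 2 * D * sqrt (\<sigma>\<^sup>2 / real b) / sqrt (real r)
      = 2 * real b * D\<^sup>2 * L / real m + 2 * D * \<sigma> / sqrt (real m)" for D
    using \<open>b > 0\<close> \<open>\<sigma> \<ge> 0\<close> r by (simp add: m real_sqrt_divide real_sqrt_mult)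
  moreover have "\<psi> (\<sigma>\<^sup>2 / real b) r = 2 * D\<^sup>2 * L / real r + 2 * D * sqrt (\<sigma>\<^sup>2 / real b) / sqrt (real r)"
    if "\<forall>v\<ge>0. \<forall>n\<ge>1. \<psi> v n = 2 * D\<^sup>2 * L / real n + 2 * D * sqrt v / sqrt (real n)" for D
    using that r by simp
  ultimately show ?thesis
    using gap by (metis r_def)
qed

end
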